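(* Let $X\subseteq\mathbb{C}$, equipped with the Euclidean metric, be either (i) a compact interval (line segment), or (ii) a (closed) circular arc that subtends an angle of at most $\pi$. Then for every $\nu\in\mathcal{M}_g(X)$ the map $$\rho_\nu\colon \mathcal{H}^\partial(X)\to\mathcal{M}_g(X),\qquad \rho_\nu(h)=h_*\nu,$$ has a $1$-Lipschitz section, i.e. there is $\sigma\colon\mathcal{M}_g(X)\to\mathcal{H}^\partial(X)$ with $\rho_\nu\circ\sigma=\mathrm{id}$ and $\sup_{x\in X}|\sigma(\mu_1)(x)-\sigma(\mu_2)(x)|\le\delta(\mu_1,\mu_2)$ for all $\mu_1,\mu_2\in\mathcal{M}_g(X)$. In particular, every such $X$ admits continuous transport.
   Context: For a compact metric space $(X,d)$, $\mathcal{M}(X)$ is the set of Borel probability measures on $X$, and $\mathcal{M}_g(X)\subseteq\mathcal{M}(X)$ is the set of fully supported diffuse (atomless) measures. The optimal matching distance is $$\delta(\mu,\nu)=\inf\{r \mid \mu(U)\le\nu(U_r)\text{ and }\nu(U)\le\mu(U_r)\text{ for all Borel }U\subseteq X\},\qquad U_r=\{x\in X\mid d(x,U)<r\}.$$ $\mathcal{H}^\partial(X)$ denotes the set of homeomorphisms $X\to X$ that fix the boundary $\partial X$ (here: the two endpoints), with the uniform metric. $h_*\nu$ is the pushforward measure. A nonempty compact path-connected metric space $(X,d)$ admits continuous transport if for every $\mu,\nu\in\mathcal{M}_g(X)$ there is a homeomorphism $h\colon X\to X$ with $h_*\nu=\mu$ and $\sup_{x\in X}d(h(x),x)\le\delta(\mu,\nu)$.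 *)

theory Defs
  imports "HOL-Complex_Analysis.Contour_Integration" "HOL-Probability.Probability_Measure"
begin

text \<open>
  A metric space \<open>(X,d)\<close> is a subset of a type of class \<open>metric_space\<close> with the induced metric,
  and \<open>restrict_space borel X\<close> is its Borel \<open>\<sigma>\<close>-algebra.
\<close>

definition borel_prob_measures :: "'a::metric_space set \<Rightarrow> 'a measure set" where
  "borel_prob_measures X = {\<mu>. prob_space \<mu> \<and> sets \<mu> = sets (restrict_space borel X)}"

definition fully_supported_on :: "'a::metric_space set \<Rightarrow> 'a measure \<Rightarrow> bool" where
  "fully_supported_on X \<mu> \<longleftrightarrow>
    (\<forall>U. openin (top_of_set X) U \<and> U \<noteq> {} \<longrightarrow> measure \<mu> U > 0)"

definition diffuse_on :: "'a::metric_space set \<Rightarrow> 'a measure \<Rightarrow> bool" where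
  "diffuse_on X \<mu> \<longleftrightarrow> (\<forall>x\<in>X. measure \<mu> {x} = 0)"

definition good_measures :: "'a::metric_space set \<Rightarrow> 'a measure set" where
  "good_measures X =
    {\<mu> \<in> borel_prob_measures X. fully_supported_on X \<mu> \<and> diffuse_on X \<mu>}"

text \<open>
  The condition \<open>U \<noteq> {}\<close> implements the convention \<open>d(x,{}) = \<infinity>\<close>, whereas \<open>infdist x {} = 0\<close>.
\<close>
definition thickening :: "'a::metric_space set \<Rightarrow> 'a set \<Rightarrow> real \<Rightarrow> 'a set" where
  "thickening X U r = {x \<in> X. U \<noteq> {} \<and> infdist x U < r}"

text \<open>
  For Borel probability measures on a bounded \<open>X\<close> the set below is nonempty, and it contains no
  \<open>r \<le> 0\<close> (take \<open>U = X\<close>), so the real infimum is the intended one.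
\<close>
definition matching_dist :: "'a::metric_space set \<Rightarrow> 'a measure \<Rightarrow> 'a measure \<Rightarrow> real" where
  "matching_dist X \<mu> \<nu> =
    Inf {r. \<forall>U \<in> sets (restrict_space borel X).
              measure \<mu> U \<le> measure \<nu> (thickening X U r) \<and>
              measure \<nu> U \<le> measure \<mu> (thickening X U r)}"

text \<open>
  Maps \<open>X \<rightarrow> X\<close> are represented by extensional functions, which are determined by their
  values on \<open>X\<close>.
\<close>
definition self_homeos :: "'a::metric_space set \<Rightarrow> ('a \<Rightarrow> 'a) set" where
  "self_homeos X = {h \<in> extensional X. \<exists>g. homeomorphism X X h g}"

definition self_homeos_fixing :: "'a::metric_space set \<Rightarrow> 'a set \<Rightarrow> ('a \<Rightarrow> 'a) set" where
  "self_homeos_fixing X B = {h \<in> self_homeos X. \<forall>x\<in>B. h x = x}"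

definition uniform_dist :: "'a::metric_space set \<Rightarrow> ('a \<Rightarrow> 'a) \<Rightarrow> ('a \<Rightarrow> 'a) \<Rightarrow> real" where
  "uniform_dist X f g = (SUP x\<in>X. dist (f x) (g x))"

definition pushforward :: "'a::metric_space set \<Rightarrow> 'a measure \<Rightarrow> ('a \<Rightarrow> 'a) \<Rightarrow> 'a measure" where
  "pushforward X \<nu> h = distr \<nu> (restrict_space borel X) h"

definition admits_continuous_transport :: "'a::metric_space set \<Rightarrow> bool" where
  "admits_continuous_transport X \<longleftrightarrow>
    X \<noteq> {} \<and> compact X \<and> path_connected X \<and>
    (\<forall>\<mu> \<in> good_measures X. \<forall>\<nu> \<in> good_measures X.
       \<exists>h \<in> self_homeos X. pushforward X \<nu> h = \<mu> \<and>
         uniform_dist X h (\<lambda>x. x) \<le> matching_dist X \<mu> \<nu>)"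

end

theory Submission
  imports Defs "HOL-Probability.Distribution_Functions"
begin

text \<open>
  Parametrise \<open>X\<close> by an arc \<open>p\<close> on \<open>[0,1]\<close> and let \<open>F\<^sub>\<mu>(t) = \<mu>(p[0,t])\<close>, an increasing
  homeomorphism of \<open>[0,1]\<close> for every good \<open>\<mu>\<close>. The section is the monotone rearrangement
  \<open>\<sigma>(\<mu>) = p \<circ> F\<^sub>\<mu>\<^sup>-\<^sup>1 \<circ> F\<^sub>\<nu> \<circ> p\<^sup>-\<^sup>1\<close>, which sends \<open>\<nu>\<close> itself to the identity.

  What makes \<open>\<sigma>\<close> 1-Lipschitz is that on a segment, and on an arc of angle at most \<open>\<pi>\<close>, the chord
  between two points grows with the parameter interval. If \<open>F\<^sub>\<mu>(a) = F\<^sub>\<nu>(b)\<close>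
  with \<open>a < b\<close> and \<open>p(a)\<close>, \<open>p(b)\<close> were more than \<open>r\<close> apart, then the \<open>r\<close>-thickening of \<open>p[0,a]\<close> would
  lie in \<open>p[0,c]\<close> for some \<open>c < b\<close>, hence have \<open>\<nu>\<close>-mass less than \<open>F\<^sub>\<nu>(b) = \<mu>(p[0,a])\<close>.
\<close>

section \<open>Good measures and their images under homeomorphisms\<close>

lemma good_measuresD:
  assumes "\<mu> \<in> good_measures X"
  shows "prob_space \<mu>" "sets \<mu> = sets (restrict_space borel X)" "space \<mu> = X"
    "\<And>U. openin (top_of_set X) U \<Longrightarrow> U \<noteq> {} \<Longrightarrow> measure \<mu> U > 0"
    "\<And>x. x \<in> X \<Longrightarrow> measure \<mu> {x} = 0"
proof -
  show s: "sets \<mu> = sets (restrict_space borel X)"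
    using assms by (simp add: good_measures_def borel_prob_measures_def)
  show "space \<mu> = X"
    using sets_eq_imp_space_eq[OF s] by (simp add: space_restrict_space)
qed (use assms in \<open>auto simp: good_measures_def borel_prob_measures_def fully_supported_on_def
      diffuse_on_def\<close>)

text \<open>The only point would need mass 1 by total mass and mass 0 by diffuseness. This settles
  the degenerate segment, where all claims about good measures become vacuous.\<close>

lemma good_measures_singleton: "good_measures {a} = {}"
proof -
  have False if "\<mu> \<in> good_measures {a}" for \<mu> :: "'a measure"
    using good_measuresD[OF that] prob_space.prob_space[of \<mu>] by force
  then show ?thesis
    by blast
qed

lemma measurable_homeo:
  assumes "homeomorphism X X h g" "sets \<nu> = sets (restrict_space borel X)"
  shows "h \<in> measurable \<nu> (restrict_space borel X)"
proof -
  have "h \<in> borel_measurable (restrict_space borel X)"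
    using assms(1) by (intro borel_measurable_continuous_on_restrict) (simp add: homeomorphism_def)
  then have "h \<in> measurable (restrict_space borel X) (restrict_space borel X)"
    using assms(1) by (intro measurable_restrict_space2)
      (auto simp: homeomorphism_def space_restrict_space)
  then show ?thesis
    by (simp cong: measurable_cong_sets add: assms(2))
qed

text \<open>A homeomorphism pulls nonempty open sets back to nonempty open sets and points back to
  points, so full support and diffuseness both survive. This is what makes the map
  \<open>\<rho>\<^sub>\<nu>\<close> land in the good measures.\<close>

lemma pushforward_good:
  fixes X :: "'a::metric_space set"
  assumes \<nu>: "\<nu> \<in> good_measures X" and h: "homeomorphism X X h g"
  shows "pushforward X \<nu> h \<in> good_measures X"
proof -
  note \<nu>D = good_measuresD[OF \<nu>]
  interpret prob_space \<nu> by (rule \<nu>D(1))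
  have hm: "h \<in> measurable \<nu> (restrict_space borel X)"
    using measurable_homeo[OF h \<nu>D(2)] .
  have meas: "measure (pushforward X \<nu> h) U = measure \<nu> (h -` U \<inter> X)"
    if "U \<in> sets (restrict_space borel X)" for U
    using measure_distr[OF hm that] by (simp add: pushforward_def \<nu>D(3))
  have "prob_space (pushforward X \<nu> h)"
    unfolding pushforward_def by (rule prob_space_distr[OF hm])
  moreover have "measure (pushforward X \<nu> h) U > 0"
    if U: "openin (top_of_set X) U" "U \<noteq> {}" for U
  proof -
    have "U \<in> sets (restrict_space borel X)"
      using U by (auto simp: openin_open sets_restrict_space)
    moreover have "openin (top_of_set X) (X \<inter> h -` U)"
      using h U by (metis continuous_on_open homeomorphism_def)
    moreover have "X \<inter> h -` U \<noteq> {}"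
    proof -
      obtain y where "y \<in> U" "y \<in> X"
        using U openin_imp_subset by blast
      then have "g y \<in> X \<inter> h -` U"
        using h by (auto simp: homeomorphism_def)
      then show ?thesis by blast
    qed
    ultimately show ?thesis
      using \<nu>D(4) meas by (simp add: Int_commute)
  qed
  moreover have "measure (pushforward X \<nu> h) {x} = 0" if "x \<in> X" for x
  proof -
    have "{x} \<in> sets (restrict_space borel X)"
      using that by (auto simp: sets_restrict_space intro!: image_eqI[of _ _ "{x}"])
    moreover have "h -` {x} \<inter> X = {g x}" and "g x \<in> X"
      using h that by (auto simp: homeomorphism_def)
    ultimately show ?thesis
      using meas \<nu>D(5) by simp
  qed
  ultimately show ?thesis
    by (simp add: good_measures_def borel_prob_measures_def fully_supported_on_def
        diffuse_on_def pushforward_def)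
qed

section \<open>Lower bounds for the matching distance\<close>

text \<open>Membership of \<open>r\<close> in the set whose infimum is
  \<open>matching_dist X \<mu> \<nu>\<close>.\<close>

definition matches :: "'a::metric_space set \<Rightarrow> 'a measure \<Rightarrow> 'a measure \<Rightarrow> real \<Rightarrow> bool" where
  "matches X \<mu> \<nu> r \<longleftrightarrow> (\<forall>U \<in> sets (restrict_space borel X).
     measure \<mu> U \<le> measure \<nu> (thickening X U r) \<and> measure \<nu> U \<le> measure \<mu> (thickening X U r))"

lemma matches_commute: "matches X \<mu> \<nu> r \<longleftrightarrow> matches X \<nu> \<mu> r"
  by (auto simp: matches_def)

text \<open>A lower bound of a set of reals lies below its \<open>Inf\<close> once the set is
  nonempty; boundedness of \<open>X\<close> supplies an admissible radius.\<close>

lemma le_matching_dist: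
  fixes X :: "'a::metric_space set"
  assumes \<mu>: "\<mu> \<in> good_measures X" and \<nu>: "\<nu> \<in> good_measures X" and "bounded X"
    and le: "\<And>r. matches X \<mu> \<nu> r \<Longrightarrow> d \<le> r"
  shows "d \<le> matching_dist X \<mu> \<nu>"
proof -
  note D = good_measuresD[OF \<mu>] good_measuresD[OF \<nu>]
  \<comment> \<open>The \<open>+ 1\<close> turns the bound by the diameter into the strict
    inequality in \<open>thickening\<close>. The empty set has empty thickening and is treated apart
    below.\<close>
  have "thickening X U (diameter X + 1) = X" if U: "U \<in> sets (restrict_space borel X)" "U \<noteq> {}" for U
  proof -
    have "infdist x U < diameter X + 1" if "x \<in> X" for x
    proof -
      obtain u where u: "u \<in> U" "u \<in> X"
        using U by (auto simp: sets_restrict_space)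
      have "infdist x U \<le> dist x u"
        using u by (simp add: infdist_le)
      also have "\<dots> \<le> diameter X"
        using diameter_bounded_bound[OF \<open>bounded X\<close> that u(2)] .
      finally show ?thesis by simp
    qed
    then show ?thesis
      using U by (auto simp: thickening_def)
  qed
  then have "measure \<mu> U \<le> measure \<nu> (thickening X U (diameter X + 1)) \<and>
      measure \<nu> U \<le> measure \<mu> (thickening X U (diameter X + 1))"
    if "U \<in> sets (restrict_space borel X)" for U
    using that prob_space.prob_space[OF D(1)] prob_space.prob_space[OF D(6)]
      prob_space.prob_le_1[OF D(1)] prob_space.prob_le_1[OF D(6)] D(3,8)
    by (cases "U = {}") auto
  then have "matches X \<mu> \<nu> (diameter X + 1)"
    by (simp add: matches_def)
  then show ?thesis
    unfolding matching_dist_def matches_def[symmetric]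
    by (intro cInf_greatest) (use le in auto)
qed

section \<open>Arcs whose chords grow with the parameter interval\<close>

text \<open>The geometric input common to segments and circular arcs of angle at most \<pi>. On a
  longer circular arc \<open>chord_mono\<close> fails: the chord between the ends is shorter than a
  diameter, which occurs as a chord inside.\<close>

locale chord_monotone_arc =
  fixes p :: "real \<Rightarrow> 'a::metric_space"
  assumes cont: "continuous_on {0..1} p"
    and inj: "inj_on p {0..1}"
    and chord_mono: "\<And>a b c d. 0 \<le> a \<Longrightarrow> a \<le> b \<Longrightarrow> b \<le> c \<Longrightarrow> c \<le> d \<Longrightarrow> d \<le> 1 \<Longrightarrow>
      dist (p b) (p c) \<le> dist (p a) (p d)"
begin

definition X :: "'a set" where "X = p ` {0..1}"

definition param :: "'a \<Rightarrow> real" where "param = the_inv_into {0..1} p"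

text \<open>The function \<open>F\<^sub>\<mu>\<close>, taken as the \<open>cdf\<close> of the image
  on the real line so that continuity off atoms and uniqueness of distribution functions apply to
  it.\<close>

definition mass_upto :: "'a measure \<Rightarrow> real \<Rightarrow> real" where
  "mass_upto \<mu> = cdf (distr \<mu> borel param)"

definition quantile :: "'a measure \<Rightarrow> real \<Rightarrow> real" where
  "quantile \<mu> = the_inv_into {0..1} (mass_upto \<mu>)"

text \<open>The \<open>restrict\<close> makes the map extensional, as membership in
  \<open>self_homeos\<close> demands.\<close>

definition rearrangement :: "'a measure \<Rightarrow> 'a measure \<Rightarrow> 'a \<Rightarrow> 'a" where
  "rearrangement \<nu> \<mu> = restrict (\<lambda>x. p (quantile \<mu> (mass_upto \<nu> (param x)))) X"

lemma compact_X: "compact X"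
  unfolding X_def using cont by (rule compact_continuous_image) simp

lemma path_connected_X: "path_connected X"
  unfolding X_def using cont by (rule path_connected_continuous_image) simp

lemma homeomorphism_p: "homeomorphism {0..1} X p param"
  unfolding homeomorphism_def
proof (intro conjI)
  show "continuous_on X param"
    unfolding X_def param_def by (rule continuous_on_inv_into[OF cont _ inj]) simp
  show "param ` X = {0..1}"
    unfolding X_def param_def using inj by (rule the_inv_into_onto)
qed (use cont inj in \<open>auto simp: X_def param_def f_the_inv_into_f the_inv_into_f_f\<close>)

lemma param_p: "t \<in> {0..1} \<Longrightarrow> param (p t) = t"
  and p_param: "x \<in> X \<Longrightarrow> p (param x) = x"
  and param_range: "x \<in> X \<Longrightarrow> param x \<in> {0..1}"
  and p_range: "t \<in> {0..1} \<Longrightarrow> p t \<in> X"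
  using homeomorphism_p unfolding homeomorphism_def by blast+

lemma param_borel: "param \<in> borel_measurable (restrict_space borel X)"
  using homeomorphism_p
  by (intro borel_measurable_continuous_on_restrict) (simp add: homeomorphism_def)

text \<open>Clamping to [0,1] extends \<open>p\<close> to a continuous map from the whole line into
  \<open>X\<close>. It is inactive on values of \<open>param\<close>, so the composite is the
  identity on \<open>X\<close>, and a measure on \<open>X\<close> is recovered from its image on the
  line.\<close>

lemma distr_param_cancel:
  assumes "sets \<mu> = sets (restrict_space borel X)"
  shows "distr (distr \<mu> borel param) (restrict_space borel X) (\<lambda>t. p (max 0 (min 1 t))) = \<mu>"
proof -
  have sp: "space \<mu> = X"
    using sets_eq_imp_space_eq[OF assms] by (simp add: space_restrict_space)
  have "continuous_on UNIV (\<lambda>t. p (max 0 (min 1 t)))"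
    by (rule continuous_on_compose2[OF cont]) (auto intro!: continuous_intros)
  then have "(\<lambda>t. p (max 0 (min 1 t))) \<in> borel_measurable borel"
    by (rule borel_measurable_continuous_onI)
  then have 1: "(\<lambda>t. p (max 0 (min 1 t))) \<in> measurable borel (restrict_space borel X)"
    by (intro measurable_restrict_space2) (auto intro!: p_range)
  have 2: "param \<in> measurable \<mu> borel"
    using param_borel by (simp cong: measurable_cong_sets add: assms)
  have "distr \<mu> (restrict_space borel X) ((\<lambda>t. p (max 0 (min 1 t))) \<circ> param)
      = distr \<mu> \<mu> (\<lambda>x. x)"
    using param_range by (intro distr_cong) (auto simp: assms sp p_param)
  then show ?thesis
    by (simp add: distr_distr[OF 1 2])
qed

section \<open>The distribution function of a good measure\<close>

context
  fixes \<mu> :: "'a measure"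
  assumes \<mu>: "\<mu> \<in> good_measures X"
begin

lemma param_measurable: "param \<in> measurable \<mu> borel"
  using param_borel by (simp cong: measurable_cong_sets add: good_measuresD(2)[OF \<mu>])

lemma real_distribution_param: "real_distribution (distr \<mu> borel param)"
  using prob_space.real_distribution_distr[OF good_measuresD(1)[OF \<mu>] param_measurable] .

lemma mass_upto_eq: "mass_upto \<mu> t = measure \<mu> {x \<in> X. param x \<le> t}"
proof -
  have "param -` {..t} \<inter> X = {x \<in> X. param x \<le> t}"
    by auto
  then show ?thesis
    by (simp add: mass_upto_def cdf_def measure_distr[OF param_measurable] good_measuresD(3)[OF \<mu>])
qed

lemma sublevel_sets [measurable]: "{x \<in> X. param x \<le> t} \<in> sets \<mu>"
  using measurable_sets[OF param_measurable, of "{..t}"]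
  by (simp add: good_measuresD(3)[OF \<mu>] vimage_def Int_def conj_commute)

lemma mass_upto_neg: "t < 0 \<Longrightarrow> mass_upto \<mu> t = 0"
proof -
  assume "t < 0"
  then have "{x \<in> X. param x \<le> t} = {}"
    using param_range by fastforce
  then show ?thesis
    by (simp only: mass_upto_eq measure_empty)
qed

lemma mass_upto_ge_1: "t \<ge> 1 \<Longrightarrow> mass_upto \<mu> t = 1"
proof -
  assume "t \<ge> 1"
  then have "{x \<in> X. param x \<le> t} = space \<mu>"
    using param_range good_measuresD(3)[OF \<mu>] by fastforce
  then show ?thesis
    by (simp add: mass_upto_eq prob_space.prob_space[OF good_measuresD(1)[OF \<mu>]])
qed

text \<open>The sublevel set at 0 is just the endpoint \<open>p 0\<close>, which is null by
  diffuseness.\<close>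

lemma mass_upto_0: "mass_upto \<mu> 0 = 0"
proof -
  have "{x \<in> X. param x \<le> 0} = {p 0}"
  proof -
    have "x = p 0" if "x \<in> X" "param x \<le> 0" for x
    proof -
      have "param x = 0"
        using param_range[OF that(1)] that(2) by simp
      then show ?thesis
        using p_param[OF that(1)] by simp
    qed
    then show ?thesis
      by (auto simp: p_range param_p)
  qed
  then show ?thesis
    by (simp add: mass_upto_eq good_measuresD(5)[OF \<mu>] p_range)
qed

text \<open>A distribution function is continuous where there is no atom. Each real number has at
  most one preimage under \<open>param\<close>, so diffuseness excludes atoms on the line.\<close>

lemma continuous_mass_upto: "continuous_on S (mass_upto \<mu>)"
proof -
  interpret real_distribution "distr \<mu> borel param"
    by (rule real_distribution_param)
  have "measure (distr \<mu> borel param) {t} = 0" for t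
  proof -
    have "param -` {t} \<inter> X = (if t \<in> {0..1} then {p t} else {})"
      using param_range p_param param_p p_range by (auto split: if_splits)
    then show ?thesis
      by (simp add: measure_distr[OF param_measurable] good_measuresD(3,5)[OF \<mu>] p_range)
  qed
  then have "isCont (mass_upto \<mu>) t" for t
    unfolding mass_upto_def by (simp add: isCont_cdf)
  then show ?thesis
    by (simp add: continuous_at_imp_continuous_on)
qed

text \<open>The open piece of the arc strictly between \<open>s\<close> and \<open>t\<close> is
  nonempty, so full support gives it positive mass.\<close>

lemma mass_upto_strict_mono:
  assumes "0 \<le> s" "s < t" "t \<le> 1"
  shows "mass_upto \<mu> s < mass_upto \<mu> t"
proof -
  interpret prob_space \<mu>
    by (rule good_measuresD(1)[OF \<mu>])
  let ?U = "X \<inter> param -` {s<..<t}"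
  have U: "openin (top_of_set X) ?U"
    using homeomorphism_p by (intro continuous_openin_preimage_gen) (auto simp: homeomorphism_def)
  have "p ((s + t) / 2) \<in> ?U"
    using assms by (auto simp: param_p intro!: p_range)
  then have "0 < measure \<mu> ?U"
    using good_measuresD(4)[OF \<mu> U] by blast
  also have "\<dots> \<le> measure \<mu> ({x \<in> X. param x \<le> t} - {x \<in> X. param x \<le> s})"
    by (intro finite_measure_mono) auto
  also have "\<dots> = mass_upto \<mu> t - mass_upto \<mu> s"
    unfolding mass_upto_eq using assms by (intro finite_measure_Diff) auto
  finally show ?thesis by simp
qed

lemma mass_upto_le_iff:
  assumes "s \<in> {0..1}" "t \<in> {0..1}"
  shows "mass_upto \<mu> s \<le> mass_upto \<mu> t \<longleftrightarrow> s \<le> t"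
  using mass_upto_strict_mono[of s t] mass_upto_strict_mono[of t s] assms
  by (cases s t rule: linorder_cases) auto

text \<open>Strict monotonicity gives injectivity, the endpoint values 0 and 1 with the intermediate
  value theorem give surjectivity, and compactness of [0,1] makes the inverse continuous.\<close>

lemma homeomorphism_mass_upto: "homeomorphism {0..1} {0..1} (mass_upto \<mu>) (quantile \<mu>)"
proof -
  have inj: "inj_on (mass_upto \<mu>) {0..1}"
    by (rule inj_onI) (metis mass_upto_le_iff order.refl order.antisym)
  have im: "mass_upto \<mu> ` {0..1} = {0..1}"
  proof
    show "mass_upto \<mu> ` {0..1} \<subseteq> {0..1}"
      using mass_upto_le_iff[of 0] mass_upto_le_iff[of _ 1] mass_upto_0 mass_upto_ge_1[of 1] by auto
    show "{0..1} \<subseteq> mass_upto \<mu> ` {0..1}"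
    proof
      fix y :: real assume "y \<in> {0..1}"
      then obtain t where "0 \<le> t" "t \<le> 1" "mass_upto \<mu> t = y"
        using IVT'[of "mass_upto \<mu>" 0 y 1] continuous_mass_upto mass_upto_0 mass_upto_ge_1[of 1]
        by auto
      then show "y \<in> mass_upto \<mu> ` {0..1}" by auto
    qed
  qed
  have "continuous_on {0..1} (quantile \<mu>)"
    unfolding quantile_def
    using continuous_on_inv_into[OF continuous_mass_upto _ inj] im by simp
  moreover have "quantile \<mu> ` {0..1} = {0..1}"
    unfolding quantile_def using the_inv_into_onto[OF inj] im by simp
  ultimately show ?thesis
    using inj im continuous_mass_upto
    by (auto simp: homeomorphism_def quantile_def f_the_inv_into_f the_inv_into_f_f)
qed

lemma mass_upto_range: "t \<in> {0..1} \<Longrightarrow> mass_upto \<mu> t \<in> {0..1}"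
  and quantile_range: "u \<in> {0..1} \<Longrightarrow> quantile \<mu> u \<in> {0..1}"
  and mass_upto_quantile: "u \<in> {0..1} \<Longrightarrow> mass_upto \<mu> (quantile \<mu> u) = u"
  and quantile_mass_upto: "t \<in> {0..1} \<Longrightarrow> quantile \<mu> (mass_upto \<mu> t) = t"
  using homeomorphism_mass_upto unfolding homeomorphism_def by blast+

end

section \<open>The rearrangement as a transport map\<close>

text \<open>Outside [0,1] the distribution functions are constant, so they agree everywhere and
  determine the image measures on the line; \<open>distr_param_cancel\<close> carries the equality
  back to \<open>X\<close>.\<close>

lemma good_measures_eqI:
  assumes \<mu>: "\<mu> \<in> good_measures X" and \<nu>: "\<nu> \<in> good_measures X"
    and eq: "\<And>t. t \<in> {0..1} \<Longrightarrow> mass_upto \<mu> t = mass_upto \<nu> t"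
  shows "\<mu> = \<nu>"
proof -
  have "mass_upto \<mu> t = mass_upto \<nu> t" for t
    using eq[of t] mass_upto_neg[OF \<mu>] mass_upto_neg[OF \<nu>] mass_upto_ge_1[OF \<mu>]
      mass_upto_ge_1[OF \<nu>] by (cases "t < 0"; cases "t > 1") auto
  then have "distr \<mu> borel param = distr \<nu> borel param"
    using cdf_unique[OF real_distribution_param[OF \<mu>] real_distribution_param[OF \<nu>]]
    by (simp add: mass_upto_def fun_eq_iff)
  then show ?thesis
    using distr_param_cancel good_measuresD(2)[OF \<mu>] good_measuresD(2)[OF \<nu>] by metis
qed

lemma homeomorphism_rearrangement:
  assumes \<mu>: "\<mu> \<in> good_measures X" and \<nu>: "\<nu> \<in> good_measures X"
  shows "\<exists>g. homeomorphism X X (rearrangement \<nu> \<mu>) g"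
proof -
  have "\<exists>g. homeomorphism X X (p \<circ> (quantile \<mu> \<circ> (mass_upto \<nu> \<circ> param))) g"
    using homeomorphism_compose[OF homeomorphism_compose[OF homeomorphism_compose[OF
          homeomorphism_symD[OF homeomorphism_p] homeomorphism_mass_upto[OF \<nu>]]
          homeomorphism_symD[OF homeomorphism_mass_upto[OF \<mu>]]] homeomorphism_p] by blast
  then obtain g where "homeomorphism X X (p \<circ> (quantile \<mu> \<circ> (mass_upto \<nu> \<circ> param))) g"
    by blast
  then have "homeomorphism X X (rearrangement \<nu> \<mu>) g"
    by (rule homeomorphism_cong) (auto simp: rearrangement_def)
  then show ?thesis by blast
qed

lemma rearrangement_fixing:
  assumes \<mu>: "\<mu> \<in> good_measures X" and \<nu>: "\<nu> \<in> good_measures X"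
  shows "rearrangement \<nu> \<mu> \<in> self_homeos_fixing X {p 0, p 1}"
proof -
  have "quantile \<mu> 0 = 0" "quantile \<mu> 1 = 1"
    using quantile_mass_upto[OF \<mu>, of 0] quantile_mass_upto[OF \<mu>, of 1]
    by (simp_all add: mass_upto_0 \<mu> mass_upto_ge_1)
  then show ?thesis
    using homeomorphism_rearrangement[OF \<mu> \<nu>]
    by (auto simp: self_homeos_fixing_def self_homeos_def rearrangement_def p_range param_p
        mass_upto_0[OF \<nu>] mass_upto_ge_1[OF \<nu>])
qed

text \<open>It suffices to compare distribution functions. By monotonicity, the preimage of the
  initial piece up to \<open>t\<close> is the initial piece up to the \<open>s\<close> with
  \<open>mass_upto \<nu> s = mass_upto \<mu> t\<close>.\<close>

lemma pushforward_rearrangement: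
  assumes \<mu>: "\<mu> \<in> good_measures X" and \<nu>: "\<nu> \<in> good_measures X"
  shows "pushforward X \<nu> (rearrangement \<nu> \<mu>) = \<mu>"
proof -
  let ?h = "rearrangement \<nu> \<mu>"
  obtain g where h: "homeomorphism X X ?h g"
    using homeomorphism_rearrangement[OF \<mu> \<nu>] by blast
  note good = pushforward_good[OF \<nu> h]
  have "mass_upto (pushforward X \<nu> ?h) t = mass_upto \<mu> t" if t: "t \<in> {0..1}" for t
  proof -
    let ?s = "quantile \<nu> (mass_upto \<mu> t)"
    have s: "?s \<in> {0..1}" "mass_upto \<nu> ?s = mass_upto \<mu> t"
      using t by (simp_all only: mass_upto_range[OF \<mu>] quantile_range[OF \<nu>] mass_upto_quantile[OF \<nu>])
    have "param (?h x) \<le> t \<longleftrightarrow> param x \<le> ?s" if x: "x \<in> X" for x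
    proof -
      let ?u = "mass_upto \<nu> (param x)"
      have u: "?u \<in> {0..1}"
        using x by (simp only: mass_upto_range[OF \<nu>] param_range)
      have "param (?h x) = quantile \<mu> ?u"
        using param_p[OF quantile_range[OF \<mu> u]] x by (simp add: rearrangement_def)
      also have "\<dots> \<le> t \<longleftrightarrow> ?u \<le> mass_upto \<mu> t"
        using mass_upto_le_iff[OF \<mu> quantile_range[OF \<mu> u] t] mass_upto_quantile[OF \<mu> u] by simp
      also have "\<dots> \<longleftrightarrow> param x \<le> ?s"
        using mass_upto_le_iff[OF \<nu> param_range[OF x] s(1)] s(2) by simp
      finally show ?thesis .
    qed
    moreover have "?h x \<in> X" if "x \<in> X" for x
      using h that by (auto simp: homeomorphism_def)
    ultimately have "?h -` {x \<in> X. param x \<le> t} \<inter> space \<nu> = {x \<in> X. param x \<le> ?s}"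
      using good_measuresD(3)[OF \<nu>] by auto
    moreover have "{x \<in> X. param x \<le> t} \<in> sets (restrict_space borel X)"
      using sublevel_sets[OF \<nu>] good_measuresD(2)[OF \<nu>] by simp
    ultimately have "mass_upto (pushforward X \<nu> ?h) t = mass_upto \<nu> ?s"
      unfolding mass_upto_eq[OF good] mass_upto_eq[OF \<nu>]
      using measure_distr[OF measurable_homeo[OF h good_measuresD(2)[OF \<nu>]]]
      by (simp add: pushforward_def)
    then show ?thesis
      using s by simp
  qed
  then show ?thesis
    by (rule good_measures_eqI[OF good \<mu>])
qed

section \<open>The Lipschitz estimate\<close>

text \<open>The test set is the initial piece up to \<open>a\<close>. This treats
  \<open>a < b\<close>; the opposite order follows by exchanging the measures, since
  \<open>matches\<close> is symmetric.\<close>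

lemma dist_le_of_mass_le:
  assumes \<mu>: "\<mu> \<in> good_measures X" and \<nu>: "\<nu> \<in> good_measures X" and r: "matches X \<mu> \<nu> r"
    and ab: "0 \<le> a" "a < b" "b \<le> 1" and mass: "mass_upto \<nu> b \<le> mass_upto \<mu> a"
  shows "dist (p a) (p b) \<le> r"
proof (rule ccontr)
  assume "\<not> dist (p a) (p b) \<le> r"
  then have far: "r < dist (p a) (p b)" by simp
  interpret prob_space \<nu>
    by (rule good_measuresD(1)[OF \<nu>])
  \<comment> \<open>By continuity one can step back from \<open>b\<close> to some
    \<open>c < b\<close> with \<open>p c\<close> still farther than \<open>r\<close> from
    \<open>p a\<close>. The mass lost between \<open>c\<close> and \<open>b\<close> makes the final
    chain of inequalities strict.\<close>
  have "continuous_on {a..b} p"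
    using cont by (rule continuous_on_subset) (use ab in auto)
  then have "continuous_on {a..b} (\<lambda>c. dist (p a) (p c))"
    by (intro continuous_intros)
  then have "((\<lambda>c. dist (p a) (p c)) \<longlongrightarrow> dist (p a) (p b)) (at b within {a..b})"
    using ab by (auto simp: continuous_on_def)
  then have "((\<lambda>c. dist (p a) (p c)) \<longlongrightarrow> dist (p a) (p b)) (at_left b)"
    using ab by (simp add: at_within_Icc_at_left)
  then have "eventually (\<lambda>c. r < dist (p a) (p c)) (at_left b)"
    using far by (rule order_tendstoD)
  moreover have "eventually (\<lambda>c. c \<in> {a<..<b}) (at_left b)"
    using ab by (intro eventually_at_leftI) auto
  ultimately have "eventually (\<lambda>c. r < dist (p a) (p c) \<and> c \<in> {a<..<b}) (at_left b)"
    by (rule eventually_conj)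
  then obtain c where c: "r < dist (p a) (p c)" "a < c" "c < b"
    using eventually_happens'[OF trivial_limit_at_left_real] by fastforce
  let ?U = "{x \<in> X. param x \<le> a}"
  have U: "?U \<in> sets (restrict_space borel X)"
    using sublevel_sets[OF \<nu>] good_measuresD(2)[OF \<nu>] by simp
  have "thickening X ?U r \<subseteq> {x \<in> X. param x \<le> c}"
  proof
    fix x assume x: "x \<in> thickening X ?U r"
    then have xX: "x \<in> X" and ne: "?U \<noteq> {}" and "infdist x ?U < r"
      unfolding thickening_def by blast+
    then have "\<not> (\<forall>y\<in>?U. r \<le> dist x y)"
      unfolding infdist_notempty[OF ne] using cINF_greatest[OF ne, of r "dist x"] by fastforce
    then obtain y where "y \<in> ?U" "dist x y < r"
      by (meson not_le)
    then have y: "y \<in> X" "param y \<le> a" "dist x y < r"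
      by simp_all
    have "param x \<le> c"
    proof (rule ccontr)
      assume "\<not> param x \<le> c"
      \<comment> \<open>The parameters of \<open>y\<close> and \<open>x\<close> enclose the interval
        from \<open>a\<close> to \<open>c\<close>, so their chord would be longer than
        \<open>r\<close>.\<close>
      then have "dist (p a) (p c) \<le> dist (p (param y)) (p (param x))"
        using chord_mono[of "param y" a c "param x"] y(2) c param_range[OF xX] param_range[OF y(1)]
        by simp
      then show False
        using y c(1) by (simp add: p_param xX dist_commute)
    qed
    then show "x \<in> {x \<in> X. param x \<le> c}"
      using xX by simp
  qed
  then have "measure \<nu> (thickening X ?U r) \<le> mass_upto \<nu> c"
    unfolding mass_upto_eq[OF \<nu>] by (intro finite_measure_mono sublevel_sets[OF \<nu>])
  also have "\<dots> < mass_upto \<nu> b"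
    using mass_upto_strict_mono[OF \<nu>, of c b] c ab by simp
  also have "\<dots> \<le> measure \<mu> ?U"
    using mass by (simp add: mass_upto_eq[OF \<mu>])
  also have "\<dots> \<le> measure \<nu> (thickening X ?U r)"
    using r U by (simp add: matches_def)
  finally show False by simp
qed

text \<open>The two images of \<open>x\<close> have parameters at which the two distribution
  functions take the same value \<open>mass_upto \<nu> (param x)\<close>, so every admissible radius
  bounds their distance.\<close>

lemma uniform_dist_rearrangement:
  assumes \<nu>: "\<nu> \<in> good_measures X"
    and \<mu>\<^sub>1: "\<mu>\<^sub>1 \<in> good_measures X" and \<mu>\<^sub>2: "\<mu>\<^sub>2 \<in> good_measures X"
  shows "uniform_dist X (rearrangement \<nu> \<mu>\<^sub>1) (rearrangement \<nu> \<mu>\<^sub>2) \<le> matching_dist X \<mu>\<^sub>1 \<mu>\<^sub>2"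
proof (rule le_matching_dist[OF \<mu>\<^sub>1 \<mu>\<^sub>2 compact_imp_bounded[OF compact_X]])
  fix r assume r: "matches X \<mu>\<^sub>1 \<mu>\<^sub>2 r"
  have "dist (rearrangement \<nu> \<mu>\<^sub>1 x) (rearrangement \<nu> \<mu>\<^sub>2 x) \<le> r" if x: "x \<in> X" for x
  proof -
    let ?u = "mass_upto \<nu> (param x)"
    let ?a = "quantile \<mu>\<^sub>1 ?u" and ?b = "quantile \<mu>\<^sub>2 ?u"
    have u: "?u \<in> {0..1}"
      using x by (simp only: mass_upto_range[OF \<nu>] param_range)
    have range: "?a \<in> {0..1}" "?b \<in> {0..1}"
      using quantile_range[OF \<mu>\<^sub>1 u] quantile_range[OF \<mu>\<^sub>2 u] .
    have eq: "mass_upto \<mu>\<^sub>1 ?a = mass_upto \<mu>\<^sub>2 ?b"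
      using mass_upto_quantile[OF \<mu>\<^sub>1 u] mass_upto_quantile[OF \<mu>\<^sub>2 u] by simp
    \<comment> \<open>Needed when \<open>?a = ?b\<close>, where the distance is 0. A negative radius
      is excluded by testing with \<open>X\<close> itself, whose thickening would be empty.\<close>
    have "0 \<le> r"
    proof (rule ccontr)
      assume "\<not> 0 \<le> r"
      then have "thickening X X r = {}"
        using infdist_nonneg[of _ X] by (auto simp: thickening_def dest: order.strict_trans1)
      moreover have "X \<in> sets (restrict_space borel X)"
        using sets.top[of "restrict_space borel X"] by (simp add: space_restrict_space)
      ultimately have "measure \<mu>\<^sub>1 X \<le> measure \<mu>\<^sub>2 {}"
        using r unfolding matches_def by metis
      then show False
        using prob_space.prob_space[OF good_measuresD(1)[OF \<mu>\<^sub>1]] good_measuresD(3)[OF \<mu>\<^sub>1]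
        by simp
    qed
    then have "dist (p ?a) (p ?b) \<le> r"
      using dist_le_of_mass_le[OF \<mu>\<^sub>1 \<mu>\<^sub>2 r, of ?a ?b] range eq
        dist_le_of_mass_le[OF \<mu>\<^sub>2 \<mu>\<^sub>1 r[unfolded matches_commute[of X \<mu>\<^sub>1]], of ?b ?a]
      by (cases ?a ?b rule: linorder_cases) (auto simp: dist_commute)
    then show ?thesis
      using x by (simp add: rearrangement_def)
  qed
  moreover have "X \<noteq> {}"
    by (simp add: X_def)
  ultimately show "uniform_dist X (rearrangement \<nu> \<mu>\<^sub>1) (rearrangement \<nu> \<mu>\<^sub>2) \<le> r"
    unfolding uniform_dist_def by (intro cSUP_least) auto
qed

lemma rearrangement_self: "\<nu> \<in> good_measures X \<Longrightarrow> x \<in> X \<Longrightarrow> rearrangement \<nu> \<nu> x = x"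
  using quantile_mass_upto[of \<nu> "param x"] param_range[of x] p_param[of x]
  by (simp add: rearrangement_def)

lemma admits_continuous_transport_X: "admits_continuous_transport X"
  unfolding admits_continuous_transport_def
proof (intro conjI ballI compact_X path_connected_X)
  show "X \<noteq> {}"
    by (simp add: X_def)
  fix \<mu> \<nu> assume \<mu>: "\<mu> \<in> good_measures X" and \<nu>: "\<nu> \<in> good_measures X"
  \<comment> \<open>The section sends \<open>\<nu>\<close> to the identity, so displacement is the
    case \<open>\<mu>\<^sub>2 = \<nu>\<close> of the Lipschitz bound.\<close>
  have "uniform_dist X (rearrangement \<nu> \<mu>) (\<lambda>x. x)
      = uniform_dist X (rearrangement \<nu> \<mu>) (rearrangement \<nu> \<nu>)"
    by (simp add: uniform_dist_def rearrangement_self[OF \<nu>])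
  also have "\<dots> \<le> matching_dist X \<mu> \<nu>"
    by (rule uniform_dist_rearrangement[OF \<nu> \<mu> \<nu>])
  finally show "\<exists>h\<in>self_homeos X. pushforward X \<nu> h = \<mu> \<and>
      uniform_dist X h (\<lambda>x. x) \<le> matching_dist X \<mu> \<nu>"
    using rearrangement_fixing[OF \<mu> \<nu>] pushforward_rearrangement[OF \<mu> \<nu>]
    by (auto simp: self_homeos_fixing_def)
qed

end

section \<open>Segments and circular arcs\<close>

text \<open>Distances along the segment are proportional to parameter differences.\<close>

lemma chord_monotone_linepath:
  fixes a b :: complex
  assumes "a \<noteq> b"
  shows "chord_monotone_arc (linepath a b)"
proof
  have dist: "dist (linepath a b s) (linepath a b t) = \<bar>s - t\<bar> * dist a b" for s t
  proof -
    have "linepath a b s - linepath a b t = (s - t) *\<^sub>R (b - a)"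
      by (simp add: linepath_def algebra_simps)
    then show ?thesis
      by (simp add: dist_norm norm_minus_commute)
  qed
  show "continuous_on {0..1} (linepath a b)"
    by (rule continuous_on_linepath)
  show "inj_on (linepath a b) {0..1}"
  proof (rule inj_onI)
    fix s t assume "linepath a b s = linepath a b t"
    then have "\<bar>s - t\<bar> * dist a b = 0"
      using dist[of s t] by simp
    then show "s = t"
      using assms by simp
  qed
  show "dist (linepath a b t) (linepath a b u) \<le> dist (linepath a b s) (linepath a b v)"
    if "s \<le> t" "t \<le> u" "u \<le> v" for s t u v
    unfolding dist using that by (intro mult_right_mono) auto
qed

text \<open>The classical chord length: a rotation factors out of the difference of exponentials,
  and the distance from \<open>exp (\<i> * \<theta>)\<close> to 1 is twice the absolute value of the
  sine of half the angle.\<close>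

lemma dist_part_circlepath:
  assumes "0 \<le> r"
  shows "dist (part_circlepath z r s t x) (part_circlepath z r s t y)
    = 2 * r * \<bar>sin ((t - s) * (x - y) / 2)\<bar>"
proof -
  let ?l = "linepath s t"
  have diff: "?l x - ?l y = (t - s) * (x - y)"
    by (simp add: linepath_def algebra_simps)
  have "part_circlepath z r s t x - part_circlepath z r s t y
      = of_real r * (exp (\<i> * of_real (?l x)) - exp (\<i> * of_real (?l y)))"
    by (simp add: part_circlepath_def algebra_simps)
  also have "exp (\<i> * of_real (?l x)) - exp (\<i> * of_real (?l y))
      = exp (\<i> * of_real (?l y)) * (exp (\<i> * of_real (?l x - ?l y)) - 1)"
    by (simp add: algebra_simps flip: exp_add)
  also have "norm (of_real r * \<dots>) = r * (2 * \<bar>sin ((?l x - ?l y) / 2)\<bar>)"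
    unfolding norm_mult dist_exp_i_1 using assms by simp
  finally show ?thesis
    unfolding diff dist_norm by simp
qed

text \<open>An angle of at most \<pi> keeps every half-angle in [0, \<pi>/2], where the sine is
  nonnegative and increasing.\<close>

lemma chord_monotone_part_circlepath:
  assumes "0 < r" "s < t" "t - s \<le> pi"
  shows "chord_monotone_arc (part_circlepath z r s t)"
proof
  let ?p = "part_circlepath z r s t"
  have dist: "dist (?p x) (?p y) = 2 * r * sin ((t - s) * (y - x) / 2)"
    and bound: "0 \<le> (t - s) * (y - x) / 2" "(t - s) * (y - x) / 2 \<le> pi / 2"
    if "0 \<le> x" "x \<le> y" "y \<le> 1" for x y
  proof -
    show 1: "0 \<le> (t - s) * (y - x) / 2"
      using that assms by simp
    have "(t - s) * (y - x) \<le> pi * 1"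
      using that assms by (intro mult_mono) auto
    then show 2: "(t - s) * (y - x) / 2 \<le> pi / 2"
      by simp
    have "0 \<le> sin ((t - s) * (y - x) / 2)"
      using 1 2 by (intro sin_ge_zero) auto
    then show "dist (?p x) (?p y) = 2 * r * sin ((t - s) * (y - x) / 2)"
      using assms dist_part_circlepath[of r z s t y x] by (simp add: dist_commute)
  qed
  show "continuous_on {0..1} ?p"
    using path_part_circlepath by (simp add: path_def)
  have "?p x \<noteq> ?p y" if "0 \<le> x" "x < y" "y \<le> 1" for x y
  proof -
    have "0 < sin ((t - s) * (y - x) / 2)"
      using that assms bound[of x y] pi_gt_zero by (intro sin_gt_zero) auto
    then have "0 < dist (?p x) (?p y)"
      using that assms dist by simp
    then show ?thesis by auto
  qed
  then show "inj_on ?p {0..1}"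
    by (intro linorder_inj_onI) auto
  show "dist (?p b) (?p c) \<le> dist (?p a) (?p d)"
    if *: "0 \<le> a" "a \<le> b" "b \<le> c" "c \<le> d" "d \<le> 1" for a b c d
  proof -
    have "(t - s) * (c - b) / 2 \<le> (t - s) * (d - a) / 2"
      using * assms by (intro divide_right_mono mult_left_mono) auto
    then have "sin ((t - s) * (c - b) / 2) \<le> sin ((t - s) * (d - a) / 2)"
      using * bound[of b c] bound[of a d] by (intro sin_monotone_2pi_le) auto
    then show ?thesis
      using * assms dist by simp
  qed
qed

section \<open>The section and continuous transport for both shapes\<close>

theorem proposition2p2:
  fixes X :: "complex set" and p :: "real \<Rightarrow> complex"
  assumes shape: "(\<exists>a b. p = linepath a b) \<or>
                  (\<exists>z r s t. 0 < r \<and> s < t \<and> t - s \<le> pi \<and> p = part_circlepath z r s t)"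
    and X: "X = path_image p"
  shows "(\<forall>\<nu> \<in> good_measures X.
            pushforward X \<nu> \<in> self_homeos_fixing X {pathstart p, pathfinish p} \<rightarrow> good_measures X \<and>
            (\<exists>\<sigma> \<in> good_measures X \<rightarrow> self_homeos_fixing X {pathstart p, pathfinish p}.
               (\<forall>\<mu> \<in> good_measures X. pushforward X \<nu> (\<sigma> \<mu>) = \<mu>) \<and>
               (\<forall>\<mu>\<^sub>1 \<in> good_measures X. \<forall>\<mu>\<^sub>2 \<in> good_measures X.
                  uniform_dist X (\<sigma> \<mu>\<^sub>1) (\<sigma> \<mu>\<^sub>2) \<le> matching_dist X \<mu>\<^sub>1 \<mu>\<^sub>2)))
         \<and> admits_continuous_transport X"
proof (cases "\<exists>a. p = linepath a a")
  \<comment> \<open>A segment may degenerate to a point. There are then no good measures, and only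
    nonemptiness, compactness and path-connectedness remain to be checked.\<close>
  case True
  then obtain a where "X = {a}"
    using X by auto
  then show ?thesis
    by (simp add: good_measures_singleton admits_continuous_transport_def)
next
  case False
  then have "chord_monotone_arc p"
    using shape chord_monotone_linepath chord_monotone_part_circlepath by metis
  then interpret arc: chord_monotone_arc p .
  have X_eq: "X = arc.X"
    by (simp add: X arc.X_def path_image_def)
  have ends: "{pathstart p, pathfinish p} = {p 0, p 1}"
    by (simp add: pathstart_def pathfinish_def)
  show ?thesis
    unfolding X_eq ends
  proof (intro conjI ballI arc.admits_continuous_transport_X)
    fix \<nu> assume \<nu>: "\<nu> \<in> good_measures arc.X"
    show "pushforward arc.X \<nu> \<in> self_homeos_fixing arc.X {p 0, p 1} \<rightarrow> good_measures arc.X"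
      using pushforward_good[OF \<nu>] by (auto simp: self_homeos_fixing_def self_homeos_def)
    show "\<exists>\<sigma> \<in> good_measures arc.X \<rightarrow> self_homeos_fixing arc.X {p 0, p 1}.
        (\<forall>\<mu> \<in> good_measures arc.X. pushforward arc.X \<nu> (\<sigma> \<mu>) = \<mu>) \<and>
        (\<forall>\<mu>\<^sub>1 \<in> good_measures arc.X. \<forall>\<mu>\<^sub>2 \<in> good_measures arc.X.
           uniform_dist arc.X (\<sigma> \<mu>\<^sub>1) (\<sigma> \<mu>\<^sub>2) \<le> matching_dist arc.X \<mu>\<^sub>1 \<mu>\<^sub>2)"
      using arc.rearrangement_fixing[OF _ \<nu>] arc.pushforward_rearrangement[OF _ \<nu>]
        arc.uniform_dist_rearrangement[OF \<nu>]
      by (intro bexI[of _ "arc.rearrangement \<nu>"]) auto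
  qed
qed

end
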